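(* Let $n\ge 1$ be an integer that is a perfect square. Then the system of ordinary differential equations $$\dot{x}=x^2-xy+n-1,\qquad \dot{y}=xy-nx^2$$ (corresponding to the Bryant soliton, i.e. the rotationally symmetric steady gradient Ricci soliton, on $\mathbb{R}^{n+1}$) passes the weak Painlevé test.
   Context: The independent variable $t$ is taken to be complex and the dot denotes $d/dt$. A system of $d$ first-order autonomous ODEs in $d$ unknown functions passes the weak Painlevé test if it admits a family of solutions with a movable singularity that are meromorphic in some rational power of the variable and have a full set of free parameters. That is: for some positive integer $Q$ there is a family of solutions given, near a point $t_0\in\mathbb{C}$, by series in powers of $(t-t_0)^{1/Q}$ with finitely many negative powers and with leading exponents fixed throughout the family, convergent in a punctured neighborhood of $t_0$ (on a branch of $(t-t_0)^{1/Q}$), with at least one component having a negative leading exponent, and the family depends on $d$ free parameters. The position $t_0$ of the singularity counts as one free parameter. The remaining free parameters are coefficients of the expansions that can be chosen arbitrarily (a leading coefficient being required to be nonzero) and independently when the series are substituted into the system and the coefficients are solved for recursively; all other coefficients are determined by these, up to finitely many choices. The case $Q=1$ (ordinary Laurent series) is allowed. Here $d=2$. *)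

theory Defs
  imports "HOL-Analysis.Analysis"
begin

definition root_branch :: "nat \<Rightarrow> complex \<Rightarrow> complex set \<Rightarrow> (complex \<Rightarrow> complex) \<Rightarrow> bool" where
  "root_branch Q t0 U s \<longleftrightarrow>
     open U \<and> t0 \<notin> U \<and> s holomorphic_on U \<and> (\<forall>t\<in>U. s t ^ Q = t - t0)"

text \<open>
  A series solution of $\dot x = F(x)$ near $t_0$ is encoded by its leading exponents
  $p_i / Q$ and its coefficient vectors $c_0, c_1, \dots$, through
  $x_i(t) = \sum_{k \ge 0} c_{k,i} s^{p_i + k}$ with $s = (t - t_0)^{1/Q}$; the index $k$ is
  counted from the leading term of each component. The series are required to
  converge and to solve the system for every branch of the root over an open part of
  a punctured disc around $t_0$; the solutions are multivalued on the whole punctured disc.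
\<close>

definition puiseux_solution ::
    "(complex^'d \<Rightarrow> complex^'d) \<Rightarrow> nat \<Rightarrow> ('d \<Rightarrow> int) \<Rightarrow> complex \<Rightarrow> (nat \<Rightarrow> complex^'d) \<Rightarrow> bool" where
  "puiseux_solution F Q p t0 c \<longleftrightarrow>
     (\<forall>i. c 0 $ i \<noteq> 0) \<and>
     (\<exists>r>0. \<forall>U s. root_branch Q t0 U s \<and> U \<subseteq> ball t0 r \<longrightarrow>
        (\<exists>x. \<forall>t\<in>U. \<forall>i.
           (\<lambda>k. c k $ i * s t powi (p i + int k)) sums (x t $ i) \<and>
           ((\<lambda>u. x u $ i) has_field_derivative F (x t) $ i) (at t)))"

text \<open>
  One system may have several families with the same exponents, distinguished by the
  leading coefficients. A family is therefore specified by \<open>Q\<close>, \<open>p\<close> and a set \<open>A\<close> of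
  vectors of leading coefficients, and it consists of all series solutions with these data.
\<close>

definition puiseux_family ::
    "(complex^'d \<Rightarrow> complex^'d) \<Rightarrow> nat \<Rightarrow> ('d \<Rightarrow> int) \<Rightarrow> (complex^'d) set \<Rightarrow> complex
       \<Rightarrow> (nat \<Rightarrow> complex^'d) set" where
  "puiseux_family F Q p A t0 = {c. puiseux_solution F Q p t0 c \<and> c 0 \<in> A}"

definition agrees_on :: "('d \<times> nat) set \<Rightarrow> ('d \<times> nat \<Rightarrow> complex) \<Rightarrow> (nat \<Rightarrow> complex^'d) \<Rightarrow> bool" where
  "agrees_on K v c \<longleftrightarrow> (\<forall>(i, k)\<in>K. c k $ i = v (i, k))"

text \<open>
  \<open>K\<close> is the set of positions (component, step) of the free coefficients and \<open>v\<close> assigns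
  values to them (the values of \<open>v\<close> off \<open>K\<close> are irrelevant). Together with $t_0$ this makes
  $d$ free parameters. The last conjunct says that the coefficients are determined
  recursively: those up to step \<open>N\<close> are fixed, up to finitely many choices, by the free
  ones among them.
\<close>

definition passes_weak_Painleve_test :: "(complex^'d \<Rightarrow> complex^'d) \<Rightarrow> bool" where
  "passes_weak_Painleve_test F \<longleftrightarrow>
     (\<exists>Q p A K.
        0 < Q \<and> (\<exists>i. p i < 0) \<and> finite K \<and> card K = CARD('d) - 1 \<and>
        (\<forall>t0 v. (\<forall>i. (i, 0) \<in> K \<longrightarrow> v (i, 0) \<noteq> 0) \<longrightarrow>
           {c \<in> puiseux_family F Q p A t0. agrees_on K v c} \<noteq> {} \<and>
           finite {c \<in> puiseux_family F Q p A t0. agrees_on K v c} \<and>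
           (\<forall>N. finite ((\<lambda>c. restrict c {..N}) `
              {c \<in> puiseux_family F Q p A t0. agrees_on (K \<inter> UNIV \<times> {..N}) v c}))))"

end

theory Submission
  imports Defs
begin

text \<open>
  Let \<open>n = m ^ 2\<close>. The system has the dominant balance $x \sim a/(t-t_0)$, $y \sim b/(t-t_0)$ with $a = -1/(m+1)$,
  $b = m/(m+1)$, and its only Kowalevski exponent other than $-1$ is $2 b = 2m/(m+1)$. So the solutions
  are sought as series in $s = (t-t_0)^{1/Q}$ with $Q = m+1$ and leading exponent $-Q$ in both components.
  The resonance is then at step $2m$, where the coefficient of \<open>x\<close> can be prescribed; with
  $t_0$ this makes two free parameters.

  The resonance is compatible for a simple reason. In the coordinates $u = y - m x$ and
  $v = y + m x$, both $\dot u$ and $\dot v$ are a multiple of \<open>x\<close> times the unknown itself, up to constants. For the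
  balance above \<open>v\<close> has leading coefficient zero, so its homogeneous recursion gives zero up to the
  resonance, and the constants of the system enter only at step $2Q = 2m+2$. Hence the recursion
  has solutions (\<open>recursion_solvable\<close>), and the coefficient at the resonance determines everything
  (\<open>recursion_unique\<close>).

  The passage between analytic solutions and coefficients is made in the variable \<open>s\<close>, in which the
  problem is single-valued and $d/dt$ is $Q^{-1} s^{-Q}$ times the Euler operator
  (\<open>puiseux_solution_iff_eventually\<close>, \<open>bryant_solution_iff_recursion\<close>). Convergence follows from a geometric
  bound: the recursion divides a quadratic convolution of about \<open>k\<close> terms by a factor of size \<open>k\<close>
  (\<open>quadratic_recursion_geometric_bound\<close>).
\<close>

section \<open>Branches of the root and Puiseux series\<close>

text \<open>
  Each sheet of the root is reached by multiplying the principal root of $(t - t_0)/z^Q$ by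
  \<open>z\<close>. Hence a condition on all branches in a disc is a condition at every small
  nonzero value \<open>z\<close> of the root, on all sheets at once.
\<close>

lemma root_branch_through:
  fixes z t0 :: complex
  assumes "0 < Q" "z \<noteq> 0" "norm z ^ Q < r"
  obtains U s where "root_branch Q t0 U s" "U \<subseteq> ball t0 r" "t0 + z ^ Q \<in> U" "s (t0 + z ^ Q) = z"
proof
  define h where "h = (\<lambda>t. (t - t0) / z ^ Q)"
  define U where "U = ball t0 r \<inter> h -` (- \<real>\<^sub>\<le>\<^sub>0)"
  define s where "s = (\<lambda>t. z * exp (Ln (h t) / of_nat Q))"
  have h: "h (t0 + z ^ Q) = 1" "h t0 = 0" using assms by (auto simp: h_def)
  have cont: "continuous_on UNIV h" unfolding h_def using assms by (intro continuous_intros) auto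
  show "U \<subseteq> ball t0 r" by (auto simp: U_def)
  show "t0 + z ^ Q \<in> U" using assms h by (auto simp: U_def dist_norm norm_power)
  show "s (t0 + z ^ Q) = z" using h by (simp add: s_def)
  show "root_branch Q t0 U s"
    unfolding root_branch_def
  proof (intro conjI ballI)
    have "open (h -` (- \<real>\<^sub>\<le>\<^sub>0))"
      by (rule open_vimage[OF _ cont]) (simp add: open_Compl)
    then show "open U" by (auto simp: U_def)
    show "t0 \<notin> U" using h by (simp add: U_def)
    show "s holomorphic_on U"
      unfolding s_def h_def using assms by (intro holomorphic_intros) (auto simp: U_def h_def)
    fix t assume "t \<in> U"
    then have "h t \<noteq> 0" by (auto simp: U_def)
    then have "exp (Ln (h t) / of_nat Q) ^ Q = h t"
      using assms by (simp flip: exp_of_nat_mult)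
    then show "s t ^ Q = t - t0" using assms by (simp add: s_def power_mult_distrib h_def)
  qed
qed

lemma root_branch_has_field_derivative:
  assumes "0 < Q" "root_branch Q t0 U s" "t \<in> U"
  shows "s t \<noteq> 0" "(s has_field_derivative s t / (of_nat Q * s t ^ Q)) (at t)"
proof -
  have U: "open U" "t0 \<notin> U" and hol: "s holomorphic_on U"
    and root: "\<And>u. u \<in> U \<Longrightarrow> s u ^ Q = u - t0"
    using assms by (auto simp: root_branch_def)
  have "s t ^ Q \<noteq> 0" using root U assms by auto
  then show nz: "s t \<noteq> 0" using assms by auto
  have der: "(s has_field_derivative deriv s t) (at t)"
    using hol U assms by (simp add: holomorphic_derivI)
  have "((\<lambda>u. s u ^ Q) has_field_derivative of_nat Q * s t ^ (Q - 1) * deriv s t) (at t)"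
    by (rule derivative_eq_intros der refl)+ (simp add: algebra_simps)
  moreover have "((\<lambda>u. s u ^ Q) has_field_derivative 1) (at t)"
  proof (rule has_field_derivative_transform_within_open[where f = "\<lambda>u. u - t0"])
    show "((\<lambda>u. u - t0) has_field_derivative 1) (at t)" by (auto intro!: derivative_eq_intros)
  qed (use root U assms in auto)
  ultimately have "of_nat Q * s t ^ (Q - 1) * deriv s t = 1"
    by (rule DERIV_unique)
  moreover have "s t ^ Q = s t * s t ^ (Q - 1)"
    using assms by (metis power_eq_if not_gr_zero)
  ultimately have "deriv s t = s t / (of_nat Q * s t ^ Q)"
    using nz assms by (simp add: field_simps)
  with der show "(s has_field_derivative s t / (of_nat Q * s t ^ Q)) (at t)" by simp
qed

definition component_fps :: "(nat \<Rightarrow> complex^'d) \<Rightarrow> 'd \<Rightarrow> complex fps" where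
  "component_fps c i = Abs_fps (\<lambda>k. c k $ i)"

lemma component_fps_nth [simp]: "fps_nth (component_fps c i) k = c k $ i"
  by (simp add: component_fps_def)

text \<open>
  Multiplication by \<open>z ^ Q\<close> turns a series with a pole of order \<open>Q\<close> into an ordinary power series.
\<close>

lemma sums_shift_powi_iff:
  fixes z :: complex
  assumes "z \<noteq> 0"
  shows "(\<lambda>k. a k * z powi (- int Q + int k)) sums X \<longleftrightarrow> (\<lambda>k. a k * z ^ k) sums (X * z ^ Q)"
proof -
  have "(\<lambda>k. a k * z powi (- int Q + int k)) sums X \<longleftrightarrow>
        (\<lambda>k. (a k * z powi (- int Q + int k)) * z ^ Q) sums (X * z ^ Q)"
    using assms by (subst sums_mult2_iff) auto
  also have "(\<lambda>k. (a k * z powi (- int Q + int k)) * z ^ Q) = (\<lambda>k. a k * z ^ k)"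
  proof
    fix k
    have "z powi (- int Q + int k) * z ^ Q = z powi (- int Q + int k + int Q)"
      using assms by (subst power_int_add) auto
    then show "(a k * z powi (- int Q + int k)) * z ^ Q = a k * z ^ k"
      by simp
  qed
  finally show ?thesis .
qed

text \<open>
  With $s^Q = t - t_0$ the chain rule gives $Q s^{Q-1} \dot s = 1$, so $d/dt$ acts on functions of \<open>s\<close> as
  $Q^{-1} s^{-Q} \, (s \, d/ds)$. The Euler operator $s \, d/ds$ multiplies $s^k$ by \<open>k\<close>; this is
  what makes the differential equation a recursion for coefficients.
\<close>

lemma quotient_along_branch_has_field_derivative:
  assumes "0 < Q" "root_branch Q t0 U s" "t \<in> U" "norm (s t) < fps_conv_radius f"
  shows "((\<lambda>u. eval_fps f (s u) / s u ^ Q) has_field_derivative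
            (s t * eval_fps (fps_deriv f) (s t) / of_nat Q - eval_fps f (s t)) / s t ^ (2 * Q)) (at t)"
proof -
  note s = root_branch_has_field_derivative[OF assms(1-3)]
  have root: "\<And>u. u \<in> U \<Longrightarrow> s u ^ Q = u - t0" and U: "open U" using assms by (auto simp: root_branch_def)
  have f: "((\<lambda>u. eval_fps f (s u)) has_field_derivative
      eval_fps (fps_deriv f) (s t) * (s t / (of_nat Q * s t ^ Q))) (at t)"
    by (rule DERIV_chain2[OF has_field_derivative_eval_fps[OF assms(4)] s(2)])
  have t: "t - t0 = s t ^ Q" using root assms by simp
  have "((\<lambda>u. eval_fps f (s u) / (u - t0)) has_field_derivative
      (eval_fps (fps_deriv f) (s t) * (s t / (of_nat Q * s t ^ Q)) * (t - t0) - eval_fps f (s t) * 1)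
        / ((t - t0) * (t - t0))) (at t)"
    by (rule DERIV_divide[OF f]) (use s(1) t in \<open>auto intro!: derivative_eq_intros\<close>)
  also have "(eval_fps (fps_deriv f) (s t) * (s t / (of_nat Q * s t ^ Q)) * (t - t0) - eval_fps f (s t) * 1)
        / ((t - t0) * (t - t0)) = (s t * eval_fps (fps_deriv f) (s t) / of_nat Q - eval_fps f (s t)) / s t ^ (2 * Q)"
    unfolding t using s(1) by (simp add: mult_2 power_add)
  finally have *: "((\<lambda>u. eval_fps f (s u) / (u - t0)) has_field_derivative
      (s t * eval_fps (fps_deriv f) (s t) / of_nat Q - eval_fps f (s t)) / s t ^ (2 * Q)) (at t)" .
  show ?thesis
    by (rule has_field_derivative_transform_within_open[OF * U \<open>t \<in> U\<close>]) (simp add: root)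
qed

text \<open>
  The multivalued problem becomes single-valued in the variable \<open>z = s t\<close>: by the
  reachability of every small nonzero \<open>z\<close> by a branch, the series solves the system along all
  branches precisely when its regular part satisfies one differential equation on a punctured
  disc in the \<open>z\<close>-plane.
\<close>

lemma puiseux_solution_iff_eventually:
  fixes F :: "complex^'d \<Rightarrow> complex^'d" and c :: "nat \<Rightarrow> complex^'d"
  assumes "0 < Q"
  defines "f \<equiv> component_fps c"
  shows "puiseux_solution F Q (\<lambda>_. - int Q) t0 c \<longleftrightarrow>
    (\<forall>i. c 0 $ i \<noteq> 0) \<and> (\<forall>i. 0 < fps_conv_radius (f i)) \<and>
    (\<forall>\<^sub>F z in at 0. \<forall>i. z * eval_fps (fps_deriv (f i)) z / of_nat Q - eval_fps (f i) z
        = z ^ (2 * Q) * F (\<chi> j. eval_fps (f j) z / z ^ Q) $ i)"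
    (is "?sol \<longleftrightarrow> ?nz \<and> ?conv \<and> ?ode")
proof (intro iffI conjI; (elim conjE)?)
  assume sol: ?sol
  then show ?nz by (simp add: puiseux_solution_def)
  from sol obtain r where r: "r > 0" and ex':
    "\<forall>U s. root_branch Q t0 U s \<and> U \<subseteq> ball t0 r \<longrightarrow>
        (\<exists>x. \<forall>t\<in>U. \<forall>i. (\<lambda>k. c k $ i * s t powi (- int Q + int k)) sums (x t $ i) \<and>
           ((\<lambda>u. x u $ i) has_field_derivative F (x t) $ i) (at t))"
    unfolding puiseux_solution_def by (elim conjE exE) (rule that)
  note ex = ex'[rule_format, OF conjI]
  \<comment> \<open>The bound \<open>1\<close> ensures that \<open>norm z < \<rho>\<close> implies \<open>norm z ^ Q < r\<close>.\<close>
  define \<rho> where "\<rho> = min r 1"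
  have \<rho>: "\<rho> > 0" using r by (simp add: \<rho>_def)
  have small: "norm z ^ Q < r" if "norm z < \<rho>" for z :: complex
  proof -
    have "norm z ^ Q \<le> norm z ^ 1"
      using that assms by (intro power_decreasing) (auto simp: \<rho>_def)
    then show ?thesis using that by (simp add: \<rho>_def)
  qed
  have summ: "summable (\<lambda>k. c k $ i * z ^ k)" if z: "z \<noteq> 0" "norm z < \<rho>" for z i
  proof -
    obtain U s where b: "root_branch Q t0 U s" "U \<subseteq> ball t0 r" "t0 + z ^ Q \<in> U" "s (t0 + z ^ Q) = z"
      using root_branch_through[OF assms(1) z(1) small[OF z(2)]] by metis
    from ex[OF b(1,2)] obtain x where
      "\<forall>t\<in>U. \<forall>i. (\<lambda>k. c k $ i * s t powi (- int Q + int k)) sums (x t $ i) \<and>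
           ((\<lambda>u. x u $ i) has_field_derivative F (x t) $ i) (at t)" by (rule exE) (rule that)
    from this[rule_format, OF b(3), THEN conjunct1, of i]
    show ?thesis unfolding b(4) sums_shift_powi_iff[OF z(1)] by (rule sums_summable)
  qed
  \<comment> \<open>A single point where all component series converge, here \<open>\<rho> / 2\<close>, gives a common disc.\<close>
  have radius: "ereal (\<rho> / 2) \<le> fps_conv_radius (f i)" for i
    using conv_radius_geI[OF summ[of "of_real (\<rho> / 2)" i]] \<rho>
    by (simp add: fps_conv_radius_def f_def)
  have "0 < ereal (\<rho> / 2)" using \<rho> by simp
  then show ?conv using radius by (metis less_le_trans)
  show ?ode
    unfolding eventually_at
  proof (intro exI[of _ "\<rho> / 2"] conjI ballI impI allI; (elim conjE)?)
    show "0 < \<rho> / 2" using \<rho> by simp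
    fix z :: complex and i assume "z \<noteq> 0" "dist z 0 < \<rho> / 2"
    then have z: "z \<noteq> 0" "norm z < \<rho> / 2" by auto
    then have "norm z < \<rho>" using \<rho> by simp
    obtain U s where b: "root_branch Q t0 U s" "U \<subseteq> ball t0 r" "t0 + z ^ Q \<in> U" "s (t0 + z ^ Q) = z"
      using root_branch_through[OF assms(1) z(1) small[OF \<open>norm z < \<rho>\<close>]] by metis
    define t where "t = t0 + z ^ Q"
    have t: "t \<in> U" "s t = z" using b by (auto simp: t_def)
    from ex[OF b(1,2)] obtain x where sol_x:
      "\<forall>t\<in>U. \<forall>i. (\<lambda>k. c k $ i * s t powi (- int Q + int k)) sums (x t $ i) \<and>
           ((\<lambda>u. x u $ i) has_field_derivative F (x t) $ i) (at t)" by (rule exE) (rule that)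
    note x = sol_x[rule_format, THEN conjunct1] and dx = sol_x[rule_format, THEN conjunct2]
    have x_eq: "x u $ j = eval_fps (f j) (s u) / s u ^ Q" if "u \<in> U" for u j
    proof -
      have su: "s u \<noteq> 0" using root_branch_has_field_derivative[OF assms(1) b(1) that] by simp
      then have "(\<lambda>k. c k $ j * s u ^ k) sums (x u $ j * s u ^ Q)"
        using x[OF that, of j] unfolding sums_shift_powi_iff[OF su] by blast
      then have "eval_fps (f j) (s u) = x u $ j * s u ^ Q"
        by (simp add: eval_fps_def f_def sums_iff)
      then show ?thesis using su by simp
    qed
    have zr: "norm (s t) < fps_conv_radius (f i)"
      using z t radius[of i] by (metis less_le_trans ereal_less(3) less_ereal.simps(1))
    have "((\<lambda>u. x u $ i) has_field_derivative
        (s t * eval_fps (fps_deriv (f i)) (s t) / of_nat Q - eval_fps (f i) (s t)) / s t ^ (2 * Q)) (at t)"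
      using quotient_along_branch_has_field_derivative[OF assms(1) b(1) t(1) zr]
      by (rule has_field_derivative_transform_within_open[where S = U])
         (use b(1) t x_eq in \<open>auto simp: root_branch_def\<close>)
    then have "(z * eval_fps (fps_deriv (f i)) z / of_nat Q - eval_fps (f i) z) / z ^ (2 * Q) = F (x t) $ i"
      using DERIV_unique[OF _ dx[OF t(1), of i]] unfolding t(2) by blast
    moreover have "x t = (\<chi> j. eval_fps (f j) z / z ^ Q)"
      using x_eq[OF t(1)] t by (simp add: vec_eq_iff)
    ultimately show "z * eval_fps (fps_deriv (f i)) z / of_nat Q - eval_fps (f i) z
        = z ^ (2 * Q) * F (\<chi> j. eval_fps (f j) z / z ^ Q) $ i"
      using z by (simp add: field_simps)
  qed
next
  assume ?nz ?conv ?ode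
  have "\<forall>\<^sub>F z::complex in at 0. \<forall>i. ereal (norm z) < fps_conv_radius (f i)"
  proof (rule eventually_all_finite)
    fix i
    have "\<forall>\<^sub>F z::complex in nhds 0. z \<in> eball 0 (fps_conv_radius (f i))"
      using \<open>?conv\<close> by (intro eventually_nhds_in_open) (auto simp: zero_ereal_def)
    then show "\<forall>\<^sub>F z::complex in at 0. ereal (norm z) < fps_conv_radius (f i)"
      by (auto simp: eventually_at_filter elim: eventually_mono)
  qed
  with \<open>?ode\<close> have "\<forall>\<^sub>F z in at 0. \<forall>i. ereal (norm z) < fps_conv_radius (f i) \<and>
      z * eval_fps (fps_deriv (f i)) z / of_nat Q - eval_fps (f i) z
        = z ^ (2 * Q) * F (\<chi> j. eval_fps (f j) z / z ^ Q) $ i"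
    by eventually_elim auto
  then obtain \<rho> where \<rho>: "\<rho> > 0" and
    conv: "\<And>(z::complex) i. z \<noteq> 0 \<Longrightarrow> norm z < \<rho> \<Longrightarrow> ereal (norm z) < fps_conv_radius (f i)" and
    ode: "\<And>z i. z \<noteq> 0 \<Longrightarrow> norm z < \<rho> \<Longrightarrow>
      z * eval_fps (fps_deriv (f i)) z / of_nat Q - eval_fps (f i) z
        = z ^ (2 * Q) * F (\<chi> j. eval_fps (f j) z / z ^ Q) $ i"
    unfolding eventually_at dist_0_norm dist_norm diff_0_right by blast
  show ?sol
    unfolding puiseux_solution_def
  proof (intro conjI exI[of _ "\<rho> ^ Q"] allI impI; (elim conjE)?)
    show "c 0 $ i \<noteq> 0" for i using \<open>?nz\<close> by simp
    show "0 < \<rho> ^ Q" using \<rho> by simp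
    fix U s assume b: "root_branch Q t0 U s" "U \<subseteq> ball t0 (\<rho> ^ Q)"
    define x where "x = (\<lambda>u. \<chi> i. eval_fps (f i) (s u) / s u ^ Q)"
    show "\<exists>x. \<forall>t\<in>U. \<forall>i. (\<lambda>k. c k $ i * s t powi (- int Q + int k)) sums (x t $ i) \<and>
           ((\<lambda>u. x u $ i) has_field_derivative F (x t) $ i) (at t)"
    proof (intro exI[of _ x] ballI allI conjI)
      fix t i assume t: "t \<in> U"
      have st: "s t \<noteq> 0" using root_branch_has_field_derivative[OF assms(1) b(1) t] by simp
      have "norm (s t) ^ Q = norm (t - t0)"
        using b(1) t by (simp add: root_branch_def flip: norm_power)
      also have "\<dots> < \<rho> ^ Q" using b(2) t by (auto simp: dist_norm norm_minus_commute)
      finally have small: "norm (s t) < \<rho>" using \<rho> by (simp add: power_less_imp_less_base)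
      note r = conv[OF st small]
      show "(\<lambda>k. c k $ i * s t powi (- int Q + int k)) sums (x t $ i)"
        using sums_eval_fps[OF r[of i]] st
        unfolding sums_shift_powi_iff[OF st] by (simp add: x_def f_def)
      have "F (x t) $ i = (s t * eval_fps (fps_deriv (f i)) (s t) / of_nat Q - eval_fps (f i) (s t)) / s t ^ (2 * Q)"
        using ode[OF st small, of i] st by (simp add: x_def field_simps)
      then show "((\<lambda>u. x u $ i) has_field_derivative F (x t) $ i) (at t)"
        using quotient_along_branch_has_field_derivative[OF assms(1) b(1) t r[of i]]
        by (simp add: x_def)
    qed
  qed
qed

section \<open>The Bryant system as an identity of formal power series\<close>

text \<open>
  The value at the centre is recovered by continuity, so an identity on a punctured disc is
  enough to compare all coefficients.
\<close>

lemma has_fps_expansion_eventually_eq_iff: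
  fixes \<phi> \<psi> :: "complex \<Rightarrow> complex"
  assumes "\<phi> has_fps_expansion P" "\<psi> has_fps_expansion R"
  shows "(\<forall>\<^sub>F z in at 0. \<phi> z = \<psi> z) \<longleftrightarrow> P = R"
proof
  assume eq: "\<forall>\<^sub>F z in at 0. \<phi> z = \<psi> z"
  have "(\<phi> \<longlongrightarrow> \<phi> 0) (at 0)" "(\<psi> \<longlongrightarrow> \<psi> 0) (at 0)"
    using assms[THEN has_fps_expansion_imp_continuous] by (auto simp: continuous_within)
  then have zero: "\<phi> 0 = \<psi> 0"
    using eq by (metis (mono_tags, lifting) tendsto_cong at_neq_bot tendsto_unique)
  from eq have "\<forall>\<^sub>F z in nhds 0. \<phi> z = \<psi> z"
    unfolding eventually_at_filter by (rule eventually_mono) (use zero in auto)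
  moreover have "\<forall>\<^sub>F z in nhds 0. eval_fps P z = \<phi> z" "\<forall>\<^sub>F z in nhds 0. eval_fps R z = \<psi> z"
    using assms by (auto simp: has_fps_expansion_def)
  ultimately have "\<forall>\<^sub>F z in nhds 0. eval_fps P z = eval_fps R z"
    by eventually_elim auto
  with assms show "P = R"
    by (intro eval_fps_eqD) (auto simp: has_fps_expansion_def)
next
  assume "P = R"
  then have "\<forall>\<^sub>F z in nhds 0. eval_fps P z = \<phi> z" "\<forall>\<^sub>F z in nhds 0. eval_fps P z = \<psi> z"
    using assms by (auto simp: has_fps_expansion_def)
  then have "\<forall>\<^sub>F z in nhds 0. \<phi> z = \<psi> z" by eventually_elim auto
  then show "\<forall>\<^sub>F z in at 0. \<phi> z = \<psi> z"
    by (auto simp: eventually_at_filter elim: eventually_mono)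
qed

definition bryant_field :: "nat \<Rightarrow> complex^2 \<Rightarrow> complex^2" where
  "bryant_field n = (\<lambda>z. vector [ (z$1)^2 - z$1 * z$2 + of_nat n - 1,
                                  z$1 * z$2 - of_nat n * (z$1)^2 ])"

lemma bryant_solution_iff_fps:
  fixes c :: "nat \<Rightarrow> complex^2"
  assumes "0 < Q"
  defines "f \<equiv> component_fps c 1" and "g \<equiv> component_fps c 2"
  shows "puiseux_solution (bryant_field n) Q (\<lambda>_. - int Q) t0 c \<longleftrightarrow>
    (\<forall>i. c 0 $ i \<noteq> 0) \<and> (\<forall>i. 0 < fps_conv_radius (component_fps c i)) \<and>
    fps_const (1 / of_nat Q) * (fps_X * fps_deriv f) - f
      = f * f - f * g + fps_const (of_nat n - 1) * fps_X ^ (2 * Q) \<and>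
    fps_const (1 / of_nat Q) * (fps_X * fps_deriv g) - g = f * g - fps_const (of_nat n) * (f * f)"
proof -
  define E where "E = (\<lambda>i z. z * eval_fps (fps_deriv (component_fps c i)) z / of_nat Q - eval_fps (component_fps c i) z
        = z ^ (2 * Q) * bryant_field n (\<chi> j. eval_fps (component_fps c j) z / z ^ Q) $ i)"
  have "(\<forall>\<^sub>F z in at 0. \<forall>i. E i z) \<longleftrightarrow>
    fps_const (1 / of_nat Q) * (fps_X * fps_deriv f) - f
      = f * f - f * g + fps_const (of_nat n - 1) * fps_X ^ (2 * Q) \<and>
    fps_const (1 / of_nat Q) * (fps_X * fps_deriv g) - g = f * g - fps_const (of_nat n) * (f * f)"
    if "\<forall>i. 0 < fps_conv_radius (component_fps c i)"
  proof -
    have rad: "fps_conv_radius f > 0" "fps_conv_radius g > 0" using that by (auto simp: f_def g_def)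
    then have rad': "fps_conv_radius (fps_deriv f) > 0" "fps_conv_radius (fps_deriv g) > 0"
      using fps_conv_radius_deriv[of f] fps_conv_radius_deriv[of g] by (metis less_le_trans)+
    have scaling: "w\<^sup>2 * ((a / w)\<^sup>2 - a * b / (w * w) + p - 1) = a * a - a * b + (p - 1) * w\<^sup>2"
      "w\<^sup>2 * (a * b / (w * w) - p * (a / w)\<^sup>2) = a * b - p * (a * a)"
      if "w \<noteq> 0" for a b p w :: complex
      using that by (simp_all add: field_simps power2_eq_square)
    note ex = rad[THEN eval_fps_has_fps_expansion] rad'[THEN eval_fps_has_fps_expansion]
    have "(\<forall>\<^sub>F z in at 0. E 1 z) \<longleftrightarrow> (\<forall>\<^sub>F z in at 0.
      1 / of_nat Q * (z * eval_fps (fps_deriv f) z) - eval_fps f z =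
      eval_fps f z * eval_fps f z - eval_fps f z * eval_fps g z + (of_nat n - 1) * z ^ (2 * Q))"
      by (rule eventually_cong[OF eventually_neq_at_within[of 0 0 UNIV]])
         (simp add: E_def bryant_field_def power_even_eq scaling flip: f_def g_def)
    also have "\<dots> \<longleftrightarrow> fps_const (1 / of_nat Q) * (fps_X * fps_deriv f) - f
      = f * f - f * g + fps_const (of_nat n - 1) * fps_X ^ (2 * Q)"
      by (rule has_fps_expansion_eventually_eq_iff) (intro fps_expansion_intros ex)+
    finally have 1: "(\<forall>\<^sub>F z in at 0. E 1 z) \<longleftrightarrow> fps_const (1 / of_nat Q) * (fps_X * fps_deriv f) - f
      = f * f - f * g + fps_const (of_nat n - 1) * fps_X ^ (2 * Q)" .
    have "(\<forall>\<^sub>F z in at 0. E 2 z) \<longleftrightarrow> (\<forall>\<^sub>F z in at 0.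
      1 / of_nat Q * (z * eval_fps (fps_deriv g) z) - eval_fps g z =
      eval_fps f z * eval_fps g z - of_nat n * (eval_fps f z * eval_fps f z))"
      by (rule eventually_cong[OF eventually_neq_at_within[of 0 0 UNIV]])
         (simp add: E_def bryant_field_def power_even_eq scaling flip: f_def g_def)
    also have "\<dots> \<longleftrightarrow> fps_const (1 / of_nat Q) * (fps_X * fps_deriv g) - g = f * g - fps_const (of_nat n) * (f * f)"
      by (rule has_fps_expansion_eventually_eq_iff) (intro fps_expansion_intros ex)+
    finally have 2: "(\<forall>\<^sub>F z in at 0. E 2 z) \<longleftrightarrow>
      fps_const (1 / of_nat Q) * (fps_X * fps_deriv g) - g = f * g - fps_const (of_nat n) * (f * f)" .
    show ?thesis unfolding forall_2 eventually_conj_iff 1 2 ..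
  qed
  then show ?thesis
    unfolding puiseux_solution_iff_eventually[OF assms(1)] E_def by blast
qed

lemma fps_nth_X_deriv: "fps_nth (fps_X * fps_deriv f) k = of_nat k * fps_nth f k"
  by (cases k) auto

section \<open>The recursion for the coefficients\<close>

text \<open>
  Let \<open>n = m ^ 2\<close>, $u = y - m x$ and $v = y + m x$. The lines \<open>u = 0\<close> and \<open>v = 0\<close> are invariant under the
  quadratic part of the field, and the system becomes
  $\dot u = (1+m) x u - m (n-1)$, $\dot v = (1-m) x v + m (n-1)$.
  The leading coefficients chosen below make the leading coefficient of \<open>v\<close> vanish. Therefore
  the equation for the \<open>k\<close>-th coefficient of \<open>v\<close> does not contain that of \<open>u\<close>, and the
  linear part of the recursion is triangular.
\<close>

definition u_coeff :: "nat \<Rightarrow> (nat \<Rightarrow> complex^2) \<Rightarrow> nat \<Rightarrow> complex" where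
  "u_coeff m c k = c k $ 2 - of_nat m * c k $ 1"

definition v_coeff :: "nat \<Rightarrow> (nat \<Rightarrow> complex^2) \<Rightarrow> nat \<Rightarrow> complex" where
  "v_coeff m c k = c k $ 2 + of_nat m * c k $ 1"

text \<open>
  The constant terms of the field are of order $s^0$ and the other terms of order at least $s^{-2Q}$,
  where \<open>Q = m + 1\<close>; so the constants appear at step \<open>2 * Q\<close> only, after the resonance at
  step \<open>2 * m\<close>.
\<close>

definition inhomogeneity :: "nat \<Rightarrow> nat \<Rightarrow> complex" where
  "inhomogeneity m k = (if k = 2 * Suc m then of_nat (Suc m) * of_nat m * (of_nat m ^ 2 - 1) else 0)"

text \<open>
  The product of the factors on the left is the Kowalevski determinant of the balance, up to a
  constant. The second factor vanishes at \<open>k = 2 * m\<close>, and only there: this is the resonance, where the free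
  coefficient enters.
\<close>

definition bryant_recursion :: "nat \<Rightarrow> (nat \<Rightarrow> complex^2) \<Rightarrow> nat \<Rightarrow> bool" where
  "bryant_recursion m c k \<longleftrightarrow>
    of_nat (k + Suc m) * u_coeff m c k = of_nat (Suc m) * v_coeff m c k
      + of_nat (Suc m) ^ 2 * (\<Sum>i=1..<k. c i $ 1 * u_coeff m c (k - i)) - inhomogeneity m k \<and>
    (of_nat k - of_nat (2 * m)) * v_coeff m c k =
      (1 - of_nat m) * of_nat (Suc m) * (\<Sum>i=1..<k. c i $ 1 * v_coeff m c (k - i)) + inhomogeneity m k"

text \<open>
  The dominant balance $x \sim a/(t-t_0)$, $y \sim b/(t-t_0)$ requires $b = a + 1$ and $(a+1)^2 = n a^2$.
  Of the two solutions $a = 1/(\pm m - 1)$ this is the one that also exists for \<open>m = 1\<close>. Since \<open>n\<close> is a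
  perfect square, the resonance $2 b$ is rational.
\<close>

definition leading_vector :: "nat \<Rightarrow> complex^2" where
  "leading_vector m = vector [- 1 / of_nat (Suc m), of_nat m / of_nat (Suc m)]"

lemma convolution_split_ends:
  fixes a b :: "nat \<Rightarrow> complex"
  assumes "0 < k"
  shows "(\<Sum>i=0..k. a i * b (k - i)) = a 0 * b k + (\<Sum>i=1..<k. a i * b (k - i)) + a k * b 0"
proof -
  obtain j where k: "k = Suc j" using assms by (cases k) auto
  have "(\<Sum>i=0..k. a i * b (k - i)) = a 0 * b k + (\<Sum>i=Suc 0..k. a i * b (k - i))"
    by (simp add: sum.atLeast_Suc_atMost)
  also have "(\<Sum>i=Suc 0..k. a i * b (k - i)) = (\<Sum>i=1..<k. a i * b (k - i)) + a k * b 0"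
    using assms unfolding k by (simp add: atLeastLessThanSuc_atLeastAtMost)
  finally show ?thesis by simp
qed

text \<open>
  The recursion is the coefficient form of the power series identities, rewritten in the
  coefficients of \<open>u\<close> and \<open>v\<close>. Step \<open>0\<close> is the dominant balance, which the leading vector satisfies.
\<close>

lemma bryant_solution_iff_recursion:
  fixes c :: "nat \<Rightarrow> complex^2"
  assumes "0 < m" and c0: "c 0 = leading_vector m"
  shows "puiseux_solution (bryant_field (m ^ 2)) (Suc m) (\<lambda>_. - int (Suc m)) t0 c \<longleftrightarrow>
    (\<forall>i. 0 < fps_conv_radius (component_fps c i)) \<and> (\<forall>k>0. bryant_recursion m c k)"
proof -
  define f g where "f = component_fps c 1" and "g = component_fps c 2"
  define M :: complex where "M = of_nat m"
  have M: "M \<noteq> 0" "1 + M \<noteq> 0" "of_nat (Suc m) = 1 + M"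
    using assms of_nat_neq_0[of m, where 'a = complex] by (auto simp: M_def)
  have c0': "c 0 $ 1 = - 1 / (1 + M)" "c 0 $ 2 = M / (1 + M)"
    unfolding c0 leading_vector_def M by (simp_all add: M_def)
  have nz: "\<forall>i. c 0 $ i \<noteq> 0"
    using c0' M by (auto simp: forall_2)
  have coeff: "(fps_const (1 / of_nat (Suc m)) * (fps_X * fps_deriv f) - f
      = f * f - f * g + fps_const (of_nat (m^2) - 1) * fps_X ^ (2 * Suc m) \<and>
    fps_const (1 / of_nat (Suc m)) * (fps_X * fps_deriv g) - g = f * g - fps_const (of_nat (m^2)) * (f * f))
    \<longleftrightarrow> (\<forall>k>0. bryant_recursion m c k)"
  proof -
    define ff fg where "ff = (\<lambda>k. \<Sum>i=0..k. c i $ 1 * c (k - i) $ 1)"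
      and "fg = (\<lambda>k. \<Sum>i=0..k. c i $ 1 * c (k - i) $ 2)"
    define d :: "nat \<Rightarrow> complex" where "d = (\<lambda>k. if k = 2 * Suc m then M^2 - 1 else 0)"
    define e1 where "e1 = (\<lambda>k. of_nat k / (1 + M) * c k $ 1 - c k $ 1 = ff k - fg k + d k)"
    define e2 where "e2 = (\<lambda>k. of_nat k / (1 + M) * c k $ 2 - c k $ 2 = fg k - M^2 * ff k)"
    have prods: "fps_nth (f * f) k = ff k" "fps_nth (f * g) k = fg k" for k
      by (simp_all add: fps_mult_nth ff_def fg_def f_def g_def)
    have lhs: "fps_nth (fps_const (1 / of_nat (Suc m)) * (fps_X * fps_deriv f) - f) k = of_nat k / (1 + M) * c k $ 1 - c k $ 1"
      "fps_nth (fps_const (1 / of_nat (Suc m)) * (fps_X * fps_deriv g) - g) k = of_nat k / (1 + M) * c k $ 2 - c k $ 2" for k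
      unfolding fps_sub_nth fps_mult_left_const_nth fps_nth_X_deriv M(3) by (simp_all add: f_def g_def)
    have rhs: "fps_nth (f * f - f * g + fps_const (of_nat (m^2) - 1) * fps_X ^ (2 * Suc m)) k = ff k - fg k + d k"
      "fps_nth (f * g - fps_const (of_nat (m^2)) * (f * f)) k = fg k - M^2 * ff k" for k
      unfolding fps_sub_nth fps_add_nth fps_mult_left_const_nth prods fps_X_power_nth
      by (simp_all add: d_def M_def)
    have all: "?thesis \<longleftrightarrow> ((\<forall>k. e1 k \<and> e2 k) \<longleftrightarrow> (\<forall>k>0. bryant_recursion m c k))"
      unfolding fps_eq_iff lhs rhs e1_def e2_def by blast
    define w where "w = - 1 / (1 + M)"
    have w: "(1 + M) * w = - 1" "c 0 $ 1 = w" "c 0 $ 2 = - M * w"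
      using M by (simp_all add: w_def c0')
    have zero: "e1 0 \<and> e2 0"
    proof -
      have vals: "ff 0 = w * w" "fg 0 = w * (- M * w)" "d 0 = 0"
        by (simp_all add: ff_def fg_def d_def w(2,3))
      have "0 - w = w * w - w * (- M * w) + 0" "0 - (- M * w) = w * (- M * w) - M^2 * (w * w)"
        using w(1) by algebra+
      then show ?thesis
        unfolding e1_def e2_def vals w(2,3) of_nat_0 div_0 mult_zero_left by blast
    qed
    have step: "e1 k \<and> e2 k \<longleftrightarrow> bryant_recursion m c k" if "k > 0" for k
    proof -
      define F G where "F = (\<Sum>i=1..<k. c i $ 1 * c (k - i) $ 1)"
        and "G = (\<Sum>i=1..<k. c i $ 1 * c (k - i) $ 2)"
      have sums: "(\<Sum>i=1..<k. c i $ 1 * u_coeff m c (k - i)) = G - M * F"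
        "(\<Sum>i=1..<k. c i $ 1 * v_coeff m c (k - i)) = G + M * F"
        unfolding u_coeff_def v_coeff_def F_def G_def M_def sum_distrib_left
          sum_subtractf[symmetric] sum.distrib[symmetric]
        by (intro sum.cong refl; simp add: algebra_simps)+
      have ffk: "ff k = 2 * c 0 $ 1 * c k $ 1 + F"
        and fgk: "fg k = c 0 $ 1 * c k $ 2 + G + c k $ 1 * c 0 $ 2"
        using convolution_split_ends[OF that, of "\<lambda>i. c i $ 1" "\<lambda>i. c i $ 1"] convolution_split_ends[OF that, of "\<lambda>i. c i $ 1" "\<lambda>i. c i $ 2"]
        unfolding ff_def fg_def F_def G_def by simp_all
      define u v where "u = u_coeff m c k" and "v = v_coeff m c k"
      have d: "inhomogeneity m k = (1 + M) * M * d k"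
        by (simp add: inhomogeneity_def d_def M(3) flip: M_def)
      define x y where "x = c k $ 1" and "y = c k $ 2"
      have uv: "u = y - M * x" "v = y + M * x"
        by (simp_all add: u_def v_def u_coeff_def v_coeff_def M_def x_def y_def)
      define l1 r1 l2 r2 where "l1 = of_nat k / (1 + M) * x - x" and "r1 = ff k - fg k + d k"
        and "l2 = of_nat k / (1 + M) * y - y" and "r2 = fg k - M^2 * ff k"
      have l: "(1 + M) * l1 = of_nat k * x - (1 + M) * x" "(1 + M) * l2 = of_nat k * y - (1 + M) * y"
        using M(2) by (simp_all add: l1_def l2_def right_diff_distrib)
      have r: "r1 = 2 * w * x + F - (w * y + G - x * M * w) + d k"
        "r2 = w * y + G - x * M * w - M^2 * (2 * w * x + F)"
        by (simp_all add: r1_def r2_def ffk fgk w x_def y_def)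
      \<comment> \<open>The recursion combines the defects \<open>l1 - r1\<close> and \<open>l2 - r2\<close> of the two equations in the same
        way as \<open>u\<close> and \<open>v\<close> combine the components; the factor \<open>1 + M\<close> clears denominators.\<close>
      have u_eq: "(of_nat k + (1 + M)) * u - ((1 + M) * v + (1 + M)\<^sup>2 * (G - M * F) - (1 + M) * M * d k)
          = (1 + M) * ((l2 - r2) - M * (l1 - r1))"
        unfolding uv r using l w(1) by algebra
      have v_eq: "(of_nat k - 2 * M) * v - ((1 - M) * (1 + M) * (G + M * F) + (1 + M) * M * d k)
          = (1 + M) * ((l2 - r2) + M * (l1 - r1))"
        unfolding uv r using l w(1) by algebra
      have "bryant_recursion m c k \<longleftrightarrow> (1 + M) * ((l2 - r2) - M * (l1 - r1)) = 0 \<and> (1 + M) * ((l2 - r2) + M * (l1 - r1)) = 0"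
        unfolding u_eq[symmetric] v_eq[symmetric] bryant_recursion_def sums d
        by (simp add: M(3) u_def v_def add.left_commute flip: M_def)
      also have "\<dots> \<longleftrightarrow> l1 = r1 \<and> l2 = r2"
      proof -
        have "A - M * B = 0 \<and> A + M * B = 0 \<longleftrightarrow> A = 0 \<and> B = 0" for A B :: complex
        proof safe
          assume *: "A - M * B = 0" "A + M * B = 0"
          have "2 * A = (A - M * B) + (A + M * B)" "2 * M * B = (A + M * B) - (A - M * B)"
            by (simp_all add: algebra_simps)
          with * M(1) show "A = 0" "B = 0" by auto
        qed auto
        then show ?thesis using M(2) by auto
      qed
      finally show ?thesis by (simp add: e1_def e2_def l1_def l2_def r1_def r2_def x_def y_def)
    qed
    show ?thesis unfolding all using step zero by (metis neq0_conv)
  qed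
  show ?thesis
    unfolding bryant_solution_iff_fps[OF zero_less_Suc] coeff[unfolded f_def g_def] using nz by blast
qed

section \<open>Convergence\<close>

text \<open>
  The quadratic convolution has fewer than \<open>k\<close> terms, and the factor \<open>k\<close> on the left, which
  comes from differentiation, absorbs their number. So the bound \<open>a k \<le> R ^ k / B\<close> reproduces itself
  as soon as \<open>B \<ge> C\<close>, and \<open>R\<close> is taken large enough for the finitely many initial terms.
\<close>

lemma quadratic_recursion_geometric_bound:
  fixes a :: "nat \<Rightarrow> real"
  assumes nonneg: "\<And>k. 0 \<le> a k"
    and rec: "\<And>k. k0 < k \<Longrightarrow> of_nat k * a k \<le> C * (\<Sum>i=1..<k. a i * a (k - i))"
  obtains D R where "0 < R" "\<And>k. a k \<le> D * R ^ k"
proof -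
  define B where "B = max C 1"
  have B: "B > 0" "C \<le> B" by (auto simp: B_def)
  define R where "R = 1 + (\<Sum>k\<le>k0. B * a k)"
  have R: "R \<ge> 1" using nonneg B by (auto simp: R_def intro!: sum_nonneg)
  have bound: "a k \<le> R ^ k / B" if "k > 0" for k
    using that
  proof (induction k rule: less_induct)
    case (less k)
    show ?case
    proof (cases "k \<le> k0")
      case True
      then have "B * a k \<le> (\<Sum>k\<le>k0. B * a k)"
        using nonneg B by (intro member_le_sum) auto
      also have "\<dots> \<le> R" by (simp add: R_def)
      also have "R \<le> R ^ k" using R less.prems self_le_power by blast
      finally show ?thesis using B by (simp add: field_simps)
    next
      case False
      have "of_nat k * a k \<le> C * (\<Sum>i=1..<k. a i * a (k - i))" using rec False by simp
      also have "\<dots> \<le> B * (\<Sum>i=1..<k. a i * a (k - i))"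
        using nonneg B by (intro mult_right_mono sum_nonneg) auto
      also have "(\<Sum>i=1..<k. a i * a (k - i)) \<le> (\<Sum>i=1..<k. R ^ i / B * (R ^ (k - i) / B))"
        using less.IH nonneg B R by (intro sum_mono mult_mono) auto
      also have "\<dots> = (\<Sum>i=1..<k. R ^ k / B ^ 2)"
        by (intro sum.cong) (auto simp: power2_eq_square simp flip: power_add)
      also have "\<dots> \<le> of_nat k * (R ^ k / B ^ 2)"
        using R B less.prems by (simp add: mult_right_mono divide_right_mono)
      finally have "of_nat k * a k \<le> B * (of_nat k * (R ^ k / B ^ 2))"
        using B by (simp add: mult_left_mono)
      also have "\<dots> = of_nat k * (R ^ k / B)"
        using B by (simp add: power2_eq_square)
      finally show ?thesis
        using less.prems by (subst (asm) mult_le_cancel_left_pos) auto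
    qed
  qed
  show thesis
  proof (rule that[of R "1 / B + a 0"])
    show "0 < R" using R by simp
    show "a k \<le> (1 / B + a 0) * R ^ k" for k
    proof (cases "k = 0")
      case False
      then have "a k \<le> 1 / B * R ^ k" using bound by simp
      also have "\<dots> \<le> (1 / B + a 0) * R ^ k" using nonneg R by (intro mult_right_mono) auto
      finally show ?thesis .
    qed (use B in simp)
  qed
qed

lemma fps_conv_radius_pos_if_geometric_bound:
  fixes f :: "complex fps"
  assumes "0 < R" "\<And>k. norm (fps_nth f k) \<le> D * R ^ k"
  shows "0 < fps_conv_radius f"
proof -
  define z :: complex where "z = of_real (1 / (2 * R))"
  have "summable (\<lambda>k. fps_nth f k * z ^ k)"
  proof (rule summable_comparison_test'[where N = 0])
    show "summable (\<lambda>k. D * (1 / 2) ^ k)"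
      by (intro summable_mult summable_geometric) auto
    fix k
    have "norm (fps_nth f k * z ^ k) = norm (fps_nth f k) * (1 / (2 * R)) ^ k"
      using assms(1) by (simp add: norm_mult norm_power z_def norm_divide)
    also have "\<dots> \<le> D * R ^ k * (1 / (2 * R)) ^ k"
      using assms by (intro mult_right_mono) auto
    also have "\<dots> = D * (1 / 2) ^ k"
      using assms(1) by (simp add: power_divide power_mult_distrib)
    finally show "norm (fps_nth f k * z ^ k) \<le> D * (1 / 2) ^ k" .
  qed
  then have "ereal (norm z) \<le> fps_conv_radius f"
    by (simp add: fps_conv_radius_def conv_radius_geI)
  moreover have "0 < ereal (norm z)" using assms(1) by (simp add: z_def)
  ultimately show ?thesis by (rule less_le_trans[rotated])
qed


text \<open>
  Past the inhomogeneity the recursion is purely quadratic, and both factors \<open>k + m + 1\<close> and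
  \<open>k - 2 * m\<close> grow like \<open>k\<close>. Hence the sum of the moduli of the \<open>k\<close>-th coefficients of \<open>u\<close> and \<open>v\<close>
  satisfies the majorant inequality.
\<close>

lemma conv_radius_pos_if_recursion:
  assumes "0 < m" and rec: "\<And>k. 0 < k \<Longrightarrow> bryant_recursion m c k"
  shows "0 < fps_conv_radius (component_fps c i)"
proof -
  define u v where "u = u_coeff m c" and "v = v_coeff m c"
  define a where "a = (\<lambda>k. norm (u k) + norm (v k))"
  define Q M where "Q = real (Suc m)" and "M = real m"
  have M: "M \<ge> 1" "Q > 0" using assms(1) by (auto simp: M_def Q_def)
  have x_bound: "norm (c k $ 1) \<le> a k" for k
  proof -
    have "v k - u k = of_real (2 * M) * c k $ 1"
      by (simp add: u_def v_def u_coeff_def v_coeff_def M_def)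
    then have "norm (v k - u k) = norm (of_real (2 * M) * c k $ 1)" by (rule arg_cong)
    also have "\<dots> = 2 * M * norm (c k $ 1)" unfolding norm_mult norm_of_real using M by simp
    finally have "2 * M * norm (c k $ 1) \<le> a k"
      using norm_triangle_ineq4[of "v k" "u k"] by (simp add: a_def)
    moreover have "1 * norm (c k $ 1) \<le> 2 * M * norm (c k $ 1)"
      using M by (intro mult_right_mono) auto
    ultimately show ?thesis by simp
  qed
  have y_bound: "norm (c k $ 2) \<le> a k" for k
  proof -
    have "2 * c k $ 2 = u k + v k" by (simp add: u_def v_def u_coeff_def v_coeff_def)
    then have "2 * norm (c k $ 2) = norm (u k + v k)" by (metis norm_mult norm_numeral)
    also have "\<dots> \<le> a k" by (simp add: a_def norm_triangle_ineq)
    finally show ?thesis using norm_ge_zero[of "c k $ 2"] by linarith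
  qed
  have conv_bound: "norm (\<Sum>i=1..<k. c i $ 1 * w (k - i)) \<le> (\<Sum>i=1..<k. a i * a (k - i))"
    if "\<And>j. norm (w j) \<le> a j" for k w
  proof (rule order_trans[OF norm_sum sum_mono])
    show "norm (c i $ 1 * w (k - i)) \<le> a i * a (k - i)" for i
      unfolding norm_mult using x_bound that by (intro mult_mono) (auto simp: a_def)
  qed
  have main: "real k * a k \<le> ((Q + 1) * ((2 * M + 1) * (M * Q)) + Q ^ 2) * (\<Sum>i=1..<k. a i * a (k - i))"
    if k: "2 * Suc m < k" for k
  proof -
    define P S T where "P = (\<Sum>i=1..<k. a i * a (k - i))"
      and "S = (\<Sum>i=1..<k. c i $ 1 * v (k - i))" and "T = (\<Sum>i=1..<k. c i $ 1 * u (k - i))"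
    have ST: "norm S \<le> P" "norm T \<le> P"
      unfolding S_def T_def P_def by (rule conv_bound; simp add: a_def)+
    have "0 < k" using k by simp
    from rec[OF this] have
      u_eq: "of_nat (k + Suc m) * u k = of_nat (Suc m) * v k + of_nat (Suc m) ^ 2 * T" and
      v_eq: "(of_nat k - of_nat (2 * m)) * v k = (1 - of_nat m) * of_nat (Suc m) * S"
      using k unfolding bryant_recursion_def inhomogeneity_def u_def v_def S_def T_def by auto
    have P: "P \<ge> 0" unfolding P_def a_def by (intro sum_nonneg) auto
    have v_bound: "real k * norm (v k) \<le> (2 * M + 1) * (M * Q) * P"
    proof -
      have "norm (of_nat k - of_nat (2 * m) :: complex) = real k - 2 * M"
      proof -
        have "(of_nat k - of_nat (2 * m) :: complex) = of_real (real k - 2 * M)"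
          by (simp add: M_def)
        also have "norm \<dots> = real k - 2 * M"
          unfolding norm_of_real using k by (simp add: M_def)
        finally show ?thesis .
      qed
      moreover have "norm (1 - of_nat m :: complex) \<le> M"
      proof -
        have "(1 - of_nat m :: complex) = of_real (1 - M)"
          by (simp add: M_def)
        also have "norm \<dots> \<le> M"
          unfolding norm_of_real using M by simp
        finally show ?thesis .
      qed
      moreover have "norm (of_nat (Suc m) :: complex) = Q" unfolding Q_def norm_of_nat ..
      ultimately have "(real k - 2 * M) * norm (v k) \<le> M * Q * P"
        using arg_cong[OF v_eq, of norm] ST P M unfolding norm_mult by (auto intro!: mult_mono)
      then have "(2 * M + 1) * ((real k - 2 * M) * norm (v k)) \<le> (2 * M + 1) * (M * Q * P)"
        using M by (intro mult_left_mono) auto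
      moreover have "real k * norm (v k) \<le> (2 * M + 1) * (real k - 2 * M) * norm (v k)"
      proof (rule mult_right_mono)
        \<comment> \<open>\<open>(2 * M + 1) * (k - 2 * M)\<close> exceeds \<open>k\<close> by exactly this product.\<close>
        have "0 \<le> 2 * M * (real k - 2 * M - 1)" using k M by (intro mult_nonneg_nonneg) (auto simp: M_def)
        then show "real k \<le> (2 * M + 1) * (real k - 2 * M)" by (simp add: algebra_simps)
      qed auto
      ultimately show ?thesis by (simp add: mult.assoc)
    qed
    have u_bound: "real k * norm (u k) \<le> Q * ((2 * M + 1) * (M * Q) * P) + Q ^ 2 * P"
    proof -
      have "real k * norm (u k) \<le> norm (of_nat (k + Suc m) * u k)"
        unfolding norm_mult norm_of_nat by (intro mult_right_mono) auto
      also have "\<dots> \<le> Q * norm (v k) + Q ^ 2 * norm T"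
        unfolding u_eq by (rule norm_triangle_le) (simp only: norm_mult norm_power norm_of_nat Q_def order_refl)
      also have "\<dots> \<le> Q * (real k * norm (v k)) + Q ^ 2 * P"
      proof -
        have "1 * norm (v k) \<le> real k * norm (v k)" using \<open>0 < k\<close> by (intro mult_right_mono) auto
        then show ?thesis using ST M by (intro add_mono mult_left_mono) auto
      qed
      also have "\<dots> \<le> Q * ((2 * M + 1) * (M * Q) * P) + Q ^ 2 * P"
        using v_bound M by (intro add_mono mult_left_mono) auto
      finally show ?thesis .
    qed
    have "real k * a k = real k * norm (u k) + real k * norm (v k)" by (simp add: a_def distrib_left)
    also have "\<dots> \<le> ((Q + 1) * ((2 * M + 1) * (M * Q)) + Q ^ 2) * P"
      using u_bound v_bound by (simp add: algebra_simps)
    finally show ?thesis by (simp only: P_def)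
  qed
  have "\<And>k. 0 \<le> a k" by (simp add: a_def)
  then obtain D R where DR: "0 < R" "\<And>k. a k \<le> D * R ^ k"
    using quadratic_recursion_geometric_bound[OF _ main] by blast
  have "i = 1 \<or> i = 2" using exhaust_2 by blast
  then have "norm (fps_nth (component_fps c i) k) \<le> D * R ^ k" for k
    using x_bound[of k] y_bound[of k] DR(2)[of k] by auto
  with DR(1) show ?thesis by (rule fps_conv_radius_pos_if_geometric_bound)
qed

section \<open>Existence and uniqueness for a given resonance coefficient\<close>

text \<open>
  At \<open>k = 2 * m\<close> the equation for \<open>v\<close> leaves its coefficient undetermined. The value used there is the
  solution of the equation for \<open>u\<close> together with $v_k - u_k = 2 m w$, which prescribes the value \<open>w\<close>
  of the \<open>k\<close>-th coefficient of \<open>x\<close>.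
\<close>

fun uv_series :: "nat \<Rightarrow> complex \<Rightarrow> nat \<Rightarrow> complex \<times> complex" where
  "uv_series m w k =
    (if k = 0 then (2 * of_nat m / of_nat (Suc m), 0)
     else let
       T = of_nat (Suc m) ^ 2 * (\<Sum>i=1..<k. (snd (uv_series m w i) - fst (uv_series m w i))
              / (2 * of_nat m) * fst (uv_series m w (k - i))) - inhomogeneity m k;
       S = (1 - of_nat m) * of_nat (Suc m) * (\<Sum>i=1..<k. (snd (uv_series m w i) - fst (uv_series m w i))
              / (2 * of_nat m) * snd (uv_series m w (k - i))) + inhomogeneity m k;
       v = if k = 2 * m then of_nat (2 * m + Suc m) * w + T / of_nat (2 * m)
           else S / (of_nat k - of_nat (2 * m))
     in ((of_nat (Suc m) * v + T) / of_nat (k + Suc m), v))"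

declare uv_series.simps [simp del]

text \<open>
  The compatibility condition at the resonance holds because the \<open>v\<close>-equation is linear in
  the lower coefficients of \<open>v\<close> and has no inhomogeneity up to step \<open>2 * m\<close>. As \<open>v\<close> starts with \<open>0\<close>,
  all its coefficients before the resonance vanish, and so does the right-hand side at it.
\<close>

lemma recursion_solvable:
  assumes "0 < m"
  shows "\<exists>c. c 0 = leading_vector m \<and> (\<forall>k>0. bryant_recursion m c k) \<and> c (2 * m) $ 1 = w"
proof -
  define u v where "u = (\<lambda>k. fst (uv_series m w k))" and "v = (\<lambda>k. snd (uv_series m w k))"
  define c :: "nat \<Rightarrow> complex^2"
    where "c = (\<lambda>k. vector [(v k - u k) / (2 * of_nat m), (u k + v k) / 2])"
  have c1: "c k $ 1 = (v k - u k) / (2 * of_nat m)" and c2: "c k $ 2 = (u k + v k) / 2" for k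
    by (simp_all add: c_def)
  have m: "(of_nat m :: complex) \<noteq> 0" using assms by simp
  have uv: "u_coeff m c k = u k" "v_coeff m c k = v k" for k
    unfolding u_coeff_def v_coeff_def c1 c2 using m by (simp_all add: field_simps)
  define T S where "T = (\<lambda>k. of_nat (Suc m) ^ 2 * (\<Sum>i=1..<k. c i $ 1 * u (k - i)) - inhomogeneity m k)"
    and "S = (\<lambda>k. (1 - of_nat m) * of_nat (Suc m) * (\<Sum>i=1..<k. c i $ 1 * v (k - i)) + inhomogeneity m k)"
  have init: "u 0 = 2 * of_nat m / of_nat (Suc m)" "v 0 = 0"
    by (simp_all add: u_def v_def uv_series.simps)
  have v_eq: "v k = (if k = 2 * m then of_nat (2 * m + Suc m) * w + T k / of_nat (2 * m)
           else S k / (of_nat k - of_nat (2 * m)))" if "k > 0" for k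
    using that unfolding T_def S_def c1 unfolding u_def v_def
    by (subst uv_series.simps) (simp add: Let_def)
  have u_eq: "u k = (of_nat (Suc m) * v k + T k) / of_nat (k + Suc m)" if "k > 0" for k
    using that unfolding T_def c1 unfolding u_def v_def
    by (subst uv_series.simps, subst (3) uv_series.simps) (simp add: Let_def)
  have c0: "c 0 = leading_vector m"
  proof -
    have "(2 * of_nat m / of_nat (Suc m)) / 2 = of_nat m / (of_nat (Suc m) :: complex)"
      unfolding divide_divide_eq_left by (subst mult.commute) (rule mult_divide_mult_cancel_left, simp)
    then show ?thesis
      using m unfolding vec_eq_iff forall_2 c1 c2 leading_vector_def init by simp
  qed
  have v_zero: "v k = 0" if "k < 2 * m" for k
    using that
  proof (induction k rule: less_induct)
    case (less k)
    show ?case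
    proof (cases "k = 0")
      case False
      have "S k = 0"
        using less by (simp add: S_def inhomogeneity_def)
      then show ?thesis using v_eq[of k] less.prems False by simp
    qed (simp add: init)
  qed
  have S_resonance: "S (2 * m) = 0"
    using v_zero by (simp add: S_def inhomogeneity_def)
  have rec: "bryant_recursion m c k" if "k > 0" for k
    unfolding bryant_recursion_def uv
  proof
    have "of_nat (k + Suc m) * u k = of_nat (Suc m) * v k + T k"
      unfolding u_eq[OF that] by (simp del: of_nat_Suc of_nat_add)
    then show "of_nat (k + Suc m) * u k = of_nat (Suc m) * v k
      + of_nat (Suc m) ^ 2 * (\<Sum>i=1..<k. c i $ 1 * u (k - i)) - inhomogeneity m k"
      by (simp add: T_def)
    have "(of_nat k - of_nat (2 * m)) * v k = S k"
    proof (cases "k = 2 * m")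
      case False
      then have "(of_nat k - of_nat (2 * m) :: complex) \<noteq> 0" by (metis of_nat_eq_iff right_minus_eq)
      then show ?thesis using v_eq[OF that] False by simp
    qed (simp add: S_resonance)
    then show "(of_nat k - of_nat (2 * m)) * v k =
      (1 - of_nat m) * of_nat (Suc m) * (\<Sum>i=1..<k. c i $ 1 * v (k - i)) + inhomogeneity m k"
      by (simp add: S_def)
  qed
  have "c (2 * m) $ 1 = w"
  proof -
    have k: "0 < 2 * m" using assms by simp
    define N :: complex where "N = of_nat m"
    have N: "N \<noteq> 0" "3 * N + 1 \<noteq> 0"
      using m of_nat_neq_0[of "3 * m", where 'a = complex] by (simp_all add: N_def add.commute)
    have "v (2 * m) = (3 * N + 1) * w + T (2 * m) / (2 * N)"
      using v_eq[OF k] by (simp add: N_def algebra_simps)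
    then have v: "2 * N * v (2 * m) = 2 * N * (3 * N + 1) * w + T (2 * m)"
      using N(1) by (simp add: distrib_left)
    have "u (2 * m) = ((N + 1) * v (2 * m) + T (2 * m)) / (3 * N + 1)"
      using u_eq[OF k] by (simp add: N_def algebra_simps)
    then have "(3 * N + 1) * u (2 * m) = (N + 1) * v (2 * m) + T (2 * m)"
      using N(2) by simp
    with v have "(3 * N + 1) * (v (2 * m) - u (2 * m)) = (3 * N + 1) * (2 * N * w)" by algebra
    then have "v (2 * m) - u (2 * m) = 2 * N * w" using N(2) by simp
    then show ?thesis using N(1) unfolding c1 N_def[symmetric] by simp
  qed
  with c0 rec show ?thesis by blast
qed

text \<open>
  Off the resonance the triangular linear system is regular. At the resonance the
  \<open>u\<close>-equation relates the difference \<open>q - m p\<close> in \<open>u\<close> to the difference \<open>q + m p\<close> in \<open>v\<close>, where \<open>p\<close> and \<open>q\<close> are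
  the differences in \<open>x\<close> and \<open>y\<close>, and for \<open>p = 0\<close> it reduces to \<open>k q = 0\<close>. The horizon \<open>N\<close> makes the
  statement apply to truncated data, which prescribe the resonance coefficient only if \<open>2 * m \<le> N\<close>.
\<close>

lemma recursion_unique:
  assumes "0 < m" and c: "c 0 = leading_vector m" "\<And>k. 0 < k \<Longrightarrow> bryant_recursion m c k"
    and c': "c' 0 = leading_vector m" "\<And>k. 0 < k \<Longrightarrow> bryant_recursion m c' k"
    and agree: "2 * m \<le> N \<Longrightarrow> c (2 * m) $ 1 = c' (2 * m) $ 1"
    and "k \<le> N"
  shows "c k = c' k"
  using \<open>k \<le> N\<close>
proof (induction k rule: less_induct)
  case (less k)
  show ?case
  proof (cases "k = 0")
    case True
    then show ?thesis using c(1) c'(1) by simp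
  next
    case False
    have uv: "u_coeff m c i = u_coeff m c' i" "v_coeff m c i = v_coeff m c' i" "c i = c' i" if "i < k" for i
      using less that by (simp_all add: u_coeff_def v_coeff_def)
    define T S where
      "T = of_nat (Suc m) ^ 2 * (\<Sum>i=1..<k. c i $ 1 * u_coeff m c (k - i)) - inhomogeneity m k"
      and "S = (1 - of_nat m) * of_nat (Suc m) * (\<Sum>i=1..<k. c i $ 1 * v_coeff m c (k - i)) + inhomogeneity m k"
    have "T = of_nat (Suc m) ^ 2 * (\<Sum>i=1..<k. c' i $ 1 * u_coeff m c' (k - i)) - inhomogeneity m k"
      "S = (1 - of_nat m) * of_nat (Suc m) * (\<Sum>i=1..<k. c' i $ 1 * v_coeff m c' (k - i)) + inhomogeneity m k"
      unfolding T_def S_def using uv by simp_all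
    then have rec: "of_nat (k + Suc m) * u_coeff m c k = of_nat (Suc m) * v_coeff m c k + T"
      "of_nat (k + Suc m) * u_coeff m c' k = of_nat (Suc m) * v_coeff m c' k + T"
      "(of_nat k - of_nat (2 * m)) * v_coeff m c k = S"
      "(of_nat k - of_nat (2 * m)) * v_coeff m c' k = S"
      using c(2)[of k] c'(2)[of k] False unfolding bryant_recursion_def T_def S_def by auto
    define p q where "p = c k $ 1 - c' k $ 1" and "q = c k $ 2 - c' k $ 2"
    define M :: complex where "M = of_nat m"
    have M: "M \<noteq> 0" using assms(1) by (simp add: M_def)
    have diff: "of_nat (k + Suc m) * (q - M * p) = of_nat (Suc m) * (q + M * p)"
      "(of_nat k - of_nat (2 * m)) * (q + M * p) = 0"
      using rec by (simp_all add: p_def q_def u_coeff_def v_coeff_def M_def algebra_simps)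
    have nz: "of_nat (k + Suc m) \<noteq> (0 :: complex)" "(of_nat k :: complex) \<noteq> 0"
      using False by (auto simp del: of_nat_Suc of_nat_add)
    have "p = 0 \<and> q = 0"
    proof (cases "k = 2 * m")
      case True
      then have p: "p = 0" using agree less.prems by (simp add: p_def)
      with diff(1) have "of_nat k * q = 0" by (simp add: algebra_simps)
      with nz p show ?thesis by simp
    next
      case False
      then have "(of_nat k - of_nat (2 * m) :: complex) \<noteq> 0" by (metis of_nat_eq_iff right_minus_eq)
      with diff(2) have "q + M * p = 0" by simp
      moreover with diff(1) nz have "q - M * p = 0" by (simp del: of_nat_Suc of_nat_add)
      ultimately have "2 * (M * p) = 0" "q = M * p" by (simp_all add: algebra_simps)
      with M show ?thesis by simp
    qed
    then show ?thesis by (simp add: vec_eq_iff forall_2 p_def q_def)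
  qed
qed

section \<open>The weak Painleve test\<close>

lemma finite_if_at_most_one:
  assumes "\<And>x y. x \<in> A \<Longrightarrow> y \<in> A \<Longrightarrow> x = y"
  shows "finite A"
proof (cases "A = {}")
  case False
  then obtain x where "x \<in> A" by blast
  with assms have "A \<subseteq> {x}" by blast
  then show ?thesis by (rule finite_subset) simp
qed simp

theorem theorem2p4:
  fixes n :: nat
  assumes "n \<ge> 1" and "\<exists>m::nat. n = m ^ 2"
  shows "passes_weak_Painleve_test
    (\<lambda>z::complex^2. vector [ (z$1)^2 - z$1 * z$2 + of_nat n - 1,
                              z$1 * z$2 - of_nat n * (z$1)^2 ])"
proof -
  obtain m where n: "n = m ^ 2" using assms(2) by blast
  with assms(1) have m: "0 < m" by (cases m) auto
  define Fam where "Fam = puiseux_family (bryant_field n) (Suc m) (\<lambda>_. - int (Suc m)) {leading_vector m}"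
  define K :: "(2 \<times> nat) set" where "K = {(1, 2 * m)}"
  have Fam_iff: "c \<in> Fam t0 \<longleftrightarrow> c 0 = leading_vector m \<and> (\<forall>k>0. bryant_recursion m c k)" for c t0
    using bryant_solution_iff_recursion[OF m, of c t0] conv_radius_pos_if_recursion[OF m, of c]
    unfolding Fam_def puiseux_family_def n by blast
  have unique: "c k = c' k"
    if "c \<in> Fam t0" "c' \<in> Fam t0" "agrees_on (K \<inter> UNIV \<times> {..N}) v c" "agrees_on (K \<inter> UNIV \<times> {..N}) v c'" "k \<le> N"
    for c c' t0 v N k
    using that by (intro recursion_unique[OF m, of c c' N k]) (auto simp: Fam_iff agrees_on_def K_def)
  have "passes_weak_Painleve_test (bryant_field n)"
    unfolding passes_weak_Painleve_test_def
  proof (intro exI conjI allI impI)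
    show "0 < Suc m" by simp
    show "(\<lambda>_. - int (Suc m)) (1 :: 2) < 0" by simp
    show "finite K" "card K = CARD(2) - 1" by (simp_all add: K_def)
    fix t0 and v :: "2 \<times> nat \<Rightarrow> complex"
    let ?fam = "puiseux_family (bryant_field n) (Suc m) (\<lambda>_. - int (Suc m)) {leading_vector m} t0"
    obtain c where c: "c 0 = leading_vector m" "\<forall>k>0. bryant_recursion m c k" "c (2 * m) $ 1 = v (1, 2 * m)"
      using recursion_solvable[OF m] by blast
    then have "c \<in> {c \<in> Fam t0. agrees_on K v c}"
      by (simp add: Fam_iff agrees_on_def K_def)
    then show "{c \<in> ?fam. agrees_on K v c} \<noteq> {}"
      unfolding Fam_def by blast
    have "c' = c''" if "c' \<in> Fam t0" "c'' \<in> Fam t0" "agrees_on K v c'" "agrees_on K v c''" for c' c''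
    proof
      fix k
      show "c' k = c'' k"
        using that by (intro unique[of c' t0 c'' k v k]) (auto simp: agrees_on_def)
    qed
    then show "finite {c \<in> ?fam. agrees_on K v c}"
      unfolding Fam_def by (intro finite_if_at_most_one) blast
    fix N
    define I where "I = (\<lambda>c. restrict c {..N}) ` {c \<in> Fam t0. agrees_on (K \<inter> UNIV \<times> {..N}) v c}"
    have "x = y" if "x \<in> I" "y \<in> I" for x y
      using that unique[of _ t0 _ N v] unfolding I_def by (auto simp: restrict_def fun_eq_iff)
    then have "finite I" by (rule finite_if_at_most_one)
    then show "finite ((\<lambda>c. restrict c {..N}) ` {c \<in> ?fam. agrees_on (K \<inter> UNIV \<times> {..N}) v c})"
      unfolding Fam_def I_def .
  qed
  then show ?thesis by (simp only: bryant_field_def)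
qed

end
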